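(* Let $A\in\mathbb{R}^{n\times n}$, $B\in\mathbb{R}^{n\times m}$, $K\in\mathbb{R}^{m\times n}$, and consider the linear networked control system in which packet exchanges between the plant and the controller are attempted at all time instants: $$x(t+1)=Ax(t)+Bu(t),\quad u(t)=(1-l(t))Kx(t),\quad x(0)=x_0,\quad t\in\mathbb{N}_0,$$ where $\{l(t)\in\{0,1\}\}_{t\in\mathbb{N}_0}$ is the binary-valued process characterizing packet exchange failures in the network. Suppose that, with $L(k)\triangleq\sum_{t=0}^{k-1}l(t)$ and a scalar $\sigma\in[0,1]$, $$\liminf_{k\to\infty}\frac{L(k)}{k}\ge\sigma\quad\text{almost surely.}$$ If there exist a positive-definite matrix $\hat P\in\mathbb{R}^{n\times n}$ and scalars $\hat\beta\in(0,1)$, $\hat\varphi\in[1,\infty)$ such that $$(A+BK)^{\mathrm T}\hat P(A+BK)-\hat\beta\hat P\ge 0,\qquad A^{\mathrm T}\hat PA-\hat\varphi\hat P\ge 0,\qquad (1-\sigma)\ln\hat\beta+\sigma\ln\hat\varphi>0,$$ then $\lim_{t\to\infty}\|x(t)\|=\infty$, almost surely.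
   Context: $\mathbb{N}_0$ denotes the nonnegative integers and $\|\cdot\|$ the Euclidean norm; $x(t)\in\mathbb{R}^n$ is the state and $u(t)\in\mathbb{R}^m$ the control input. Matrix inequalities are in the semidefinite sense for symmetric matrices. $l(t)=1$ indicates that the packet exchange attempted at time $t$ fails (the input is then set to $0$), and $l(t)=0$ that it succeeds.
   Formalization: The initial state x_0 is assumed to be nonzero; for x_0 = 0 the trajectory is identically zero and the claimed divergence of the norm fails. *)

theory Defs
  imports "HOL-Probability.Probability"
begin

text \<open>Definiteness is only considered for symmetric matrices, as usual for matrix inequalities.\<close>

definition psd :: "real^'n^'n \<Rightarrow> bool" where
  "psd Q \<longleftrightarrow> transpose Q = Q \<and> (\<forall>v. 0 \<le> v \<bullet> (Q *v v))"

definition pos_def :: "real^'n^'n \<Rightarrow> bool" where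
  "pos_def Q \<longleftrightarrow> transpose Q = Q \<and> (\<forall>v. v \<noteq> 0 \<longrightarrow> 0 < v \<bullet> (Q *v v))"

definition loss_count :: "(nat \<Rightarrow> 'w \<Rightarrow> nat) \<Rightarrow> nat \<Rightarrow> 'w \<Rightarrow> nat" where
  "loss_count l k \<omega> = (\<Sum>t<k. l t \<omega>)"

end

theory Submission
  imports Defs
begin

text \<open>The quadratic form \<open>V v = v \<bullet> (P *v v)\<close> grows along the trajectory by a factor of at least
  \<open>\<phi>\<close> at each failure and \<open>\<beta>\<close> at each success, so \<open>ln V\<close> grows by at least
  \<open>t * ln \<beta> + L t * (ln \<phi> - ln \<beta>)\<close>. As \<open>ln \<phi> - ln \<beta> > 0\<close>, a lower bound on the failure
  ratio \<open>L t / t\<close> slightly below \<open>\<sigma>\<close> makes this at least linear in \<open>t\<close> with positive slope,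
  while \<open>V v\<close> is at most a multiple of the squared norm of \<open>v\<close>.\<close>

text \<open>Evaluating the semidefinite form at \<open>v\<close> and moving
  \<open>transpose M\<close> across the inner product turns the matrix inequality into a one-step
  growth bound for the quadratic form of \<open>P\<close> under \<open>M\<close>.\<close>

lemma psd_congruence_diff_bound:
  fixes M P :: "real^'n^'n"
  assumes "psd (transpose M ** P ** M - c *\<^sub>R P)"
  shows "c * (v \<bullet> (P *v v)) \<le> (M *v v) \<bullet> (P *v (M *v v))"
proof -
  have "0 \<le> v \<bullet> ((transpose M ** P ** M - c *\<^sub>R P) *v v)"
    using assms by (auto simp: psd_def)
  also have "\<dots> = v \<bullet> (transpose M *v (P *v (M *v v))) - c * (v \<bullet> (P *v v))"
    by (simp add: matrix_vector_mult_diff_rdistrib inner_diff_right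
        scaleR_matrix_vector_assoc[symmetric] matrix_vector_mul_assoc[symmetric])
  also have "v \<bullet> (transpose M *v (P *v (M *v v))) = (M *v v) \<bullet> (P *v (M *v v))"
    by (metis dot_lmul_matrix vector_transpose_matrix)
  finally show ?thesis by simp
qed

lemma quadratic_form_le_onorm:
  fixes P :: "real^'n^'n"
  shows "v \<bullet> (P *v v) \<le> onorm ((*v) P) * (norm v)\<^sup>2"
proof -
  have "v \<bullet> (P *v v) \<le> norm v * norm (P *v v)"
    by (rule norm_cauchy_schwarz)
  also have "\<dots> \<le> norm v * (onorm ((*v) P) * norm v)"
    by (intro mult_left_mono onorm matrix_vector_mul_bounded_linear) simp
  finally show ?thesis by (simp add: power2_eq_square algebra_simps)
qed

text \<open>Induction on \<open>k\<close>: positive factors preserve the bound. Grouping the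
  exponent by the failure count, rather than by successes and failures, makes it monotone in that
  count when \<beta> \<le> \<phi>.\<close>

lemma switched_growth_lower_bound:
  fixes V :: "nat \<Rightarrow> real" and l :: "nat \<Rightarrow> nat"
  assumes "\<And>t. l t \<in> {0, 1}" and "0 < \<beta>" "0 < \<phi>" "0 \<le> V 0"
    and "\<And>t. l t = 0 \<Longrightarrow> \<beta> * V t \<le> V (Suc t)"
    and "\<And>t. l t = 1 \<Longrightarrow> \<phi> * V t \<le> V (Suc t)"
  shows "V 0 * exp (real k * ln \<beta> + real (\<Sum>t<k. l t) * (ln \<phi> - ln \<beta>)) \<le> V k"
proof (induction k)
  case 0
  show ?case by simp
next
  case (Suc k)
  let ?e = "\<lambda>k. real k * ln \<beta> + real (\<Sum>t<k. l t) * (ln \<phi> - ln \<beta>)"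
  consider "l k = 0" | "l k = 1" using assms(1)[of k] by auto
  then show ?case
  proof cases
    case 1
    then have "exp (?e (Suc k)) = \<beta> * exp (?e k)"
      using assms(2) by (simp add: algebra_simps exp_add exp_diff)
    moreover have "\<beta> * (V 0 * exp (?e k)) \<le> \<beta> * V k"
      using Suc assms(2) by (intro mult_left_mono) auto
    ultimately show ?thesis using assms(5)[OF 1] by (simp add: algebra_simps)
  next
    case 2
    then have "?e (Suc k) = ln \<phi> + ?e k" by (simp add: algebra_simps)
    then have "exp (?e (Suc k)) = \<phi> * exp (?e k)"
      using assms(3) by (simp only: exp_add exp_ln)
    moreover have "\<phi> * (V 0 * exp (?e k)) \<le> \<phi> * V k"
      using Suc assms(3) by (intro mult_left_mono) auto
    ultimately show ?thesis using assms(6)[OF 2] by (simp add: algebra_simps)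
  qed
qed

text \<open>By continuity, strict positivity at \<sigma> persists slightly to the left. This slack
  is needed because a liminf of at least \<sigma> only keeps the ratios eventually above each
  \<open>s < \<sigma>\<close>.\<close>

lemma exists_below_affine_pos:
  fixes \<sigma> a b :: real
  assumes "(1 - \<sigma>) * a + \<sigma> * b > 0"
  obtains s where "s < \<sigma>" "(1 - s) * a + s * b > 0"
proof -
  have "((\<lambda>s. (1 - s) * a + s * b) \<longlongrightarrow> (1 - \<sigma>) * a + \<sigma> * b) (at_left \<sigma>)"
    by (intro tendsto_intros)
  then have "\<forall>\<^sub>F s in at_left \<sigma>. (1 - s) * a + s * b > 0"
    using assms by (rule order_tendstoD)
  moreover have "\<forall>\<^sub>F s in at_left \<sigma>. s < \<sigma>"
    by (auto simp: eventually_at_filter)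
  ultimately have "\<forall>\<^sub>F s in at_left \<sigma>. s < \<sigma> \<and> (1 - s) * a + s * b > 0"
    by eventually_elim simp
  then show ?thesis
    using that eventually_happens'[OF trivial_limit_at_left_real] by blast
qed

text \<open>This is the deterministic statement for a single sample path, with \<open>F\<close> the
  dynamics after a successful exchange and \<open>G\<close> those after a failure.\<close>

lemma switched_trajectory_diverges:
  fixes F G P :: "real^'n^'n" and y :: "nat \<Rightarrow> real^'n" and l :: "nat \<Rightarrow> nat"
  assumes P: "pos_def P"
    and \<beta>: "0 < \<beta>" and \<beta>\<phi>: "\<beta> \<le> \<phi>"
    and F: "psd (transpose F ** P ** F - \<beta> *\<^sub>R P)"
    and G: "psd (transpose G ** P ** G - \<phi> *\<^sub>R P)"
    and pos: "(1 - \<sigma>) * ln \<beta> + \<sigma> * ln \<phi> > 0"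
    and l: "\<And>t. l t \<in> {0, 1}"
    and y0: "y 0 \<noteq> 0"
    and succ: "\<And>t. l t = 0 \<Longrightarrow> y (Suc t) = F *v y t"
    and fail: "\<And>t. l t = 1 \<Longrightarrow> y (Suc t) = G *v y t"
    and lim: "ereal \<sigma> \<le> liminf (\<lambda>k. ereal (real (\<Sum>t<k. l t) / real k))"
  shows "filterlim (\<lambda>t. norm (y t)) at_top sequentially"
proof -
  define V where "V t = y t \<bullet> (P *v y t)" for t
  define C where "C = onorm ((*v) P)"
  have V0: "V 0 > 0" using P y0 by (auto simp: V_def pos_def_def)
  have VC: "V t \<le> C * (norm (y t))\<^sup>2" for t
    unfolding V_def C_def by (rule quadratic_form_le_onorm)
  have C: "C > 0"
    using VC[of 0] V0 by (smt (verit) mult_nonpos_nonneg zero_le_power2)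
  obtain s where s: "s < \<sigma>" and d: "(1 - s) * ln \<beta> + s * ln \<phi> > 0"
    using exists_below_affine_pos[OF pos] .
  \<comment> \<open>\<open>d\<close> is the guaranteed growth rate of \<open>ln V\<close> per time
    step when the failure ratio is at least \<open>s\<close>.\<close>
  define d where "d = (1 - s) * ln \<beta> + s * ln \<phi>"
  have "ereal s < liminf (\<lambda>k. ereal (real (\<Sum>t<k. l t) / real k))"
    using s lim by (metis less_ereal.simps(1) order_less_le_trans)
  then have "\<forall>\<^sub>F k in sequentially. ereal s < ereal (real (\<Sum>t<k. l t) / real k)"
    by (rule less_LiminfD)
  \<comment> \<open>A positive \<open>k\<close> allows the denominator of the failure ratio to be
    cleared.\<close>
  moreover have "\<forall>\<^sub>F k in sequentially. 0 < k"
    by (rule eventually_gt_at_top)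
  ultimately have low: "\<forall>\<^sub>F k in sequentially. V 0 / C * exp (real k * d) \<le> (norm (y k))\<^sup>2"
  proof eventually_elim
    case (elim k)
    have "real k * s \<le> real (\<Sum>t<k. l t)"
      using elim by (simp add: field_simps)
    \<comment> \<open>The assumption \<beta> \<le> \<phi> enters here: more failures can only raise
      the lower bound.\<close>
    then have "real k * s * (ln \<phi> - ln \<beta>) \<le> real (\<Sum>t<k. l t) * (ln \<phi> - ln \<beta>)"
      using \<beta> \<beta>\<phi> by (intro mult_right_mono) auto
    then have "real k * d \<le> real k * ln \<beta> + real (\<Sum>t<k. l t) * (ln \<phi> - ln \<beta>)"
      by (simp add: d_def algebra_simps)
    then have "V 0 * exp (real k * d)
        \<le> V 0 * exp (real k * ln \<beta> + real (\<Sum>t<k. l t) * (ln \<phi> - ln \<beta>))"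
      using V0 by simp
    also have "\<dots> \<le> V k"
      using \<beta> \<beta>\<phi> V0 l succ fail psd_congruence_diff_bound[OF F] psd_congruence_diff_bound[OF G]
      by (intro switched_growth_lower_bound) (auto simp: V_def)
    also note VC[of k]
    finally show ?case using C by (simp add: field_simps)
  qed
  have "filterlim (\<lambda>k. real k * d) at_top sequentially"
    using d by (intro filterlim_at_top_mult_tendsto_pos[OF tendsto_const]
        filterlim_real_sequentially) (simp add: d_def)
  then have "filterlim (\<lambda>k. exp (real k * d)) at_top sequentially"
    by (rule filterlim_compose[OF exp_at_top])
  then have "filterlim (\<lambda>k. V 0 / C * exp (real k * d)) at_top sequentially"
    using V0 C by (intro filterlim_tendsto_pos_mult_at_top[OF tendsto_const]) auto
  then have "filterlim (\<lambda>k. (norm (y k))\<^sup>2) at_top sequentially"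
    using low by (rule filterlim_at_top_mono)
  from filterlim_compose[OF sqrt_at_top this] show ?thesis by simp
qed

theorem theorem4p2:
  fixes A :: "real^'n^'n" and B :: "real^'m^'n" and K :: "real^'n^'m"
    and M :: "'w measure"
    and l :: "nat \<Rightarrow> 'w \<Rightarrow> nat"
    and x :: "nat \<Rightarrow> 'w \<Rightarrow> real^'n" and u :: "nat \<Rightarrow> 'w \<Rightarrow> real^'m"
    and x0 :: "real^'n" and \<sigma> :: real
  assumes "prob_space M"
    and "\<And>t. l t \<in> measurable M (count_space {0, 1})"
    and "\<And>t \<omega>. \<omega> \<in> space M \<Longrightarrow> x (t + 1) \<omega> = A *v x t \<omega> + B *v u t \<omega>"
    and "\<And>t \<omega>. \<omega> \<in> space M \<Longrightarrow> u t \<omega> = (1 - real (l t \<omega>)) *\<^sub>R (K *v x t \<omega>)"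
    and "\<And>\<omega>. \<omega> \<in> space M \<Longrightarrow> x 0 \<omega> = x0"
    and "x0 \<noteq> 0"
    and "\<sigma> \<in> {0..1}"
    and "AE \<omega> in M. liminf (\<lambda>k. ereal (real (loss_count l k \<omega>) / real k)) \<ge> ereal \<sigma>"
    and "\<exists>(P :: real^'n^'n) (\<beta> :: real) (\<phi> :: real).
           pos_def P \<and> \<beta> \<in> {0<..<1} \<and> \<phi> \<in> {1..} \<and>
           psd (transpose (A + B ** K) ** P ** (A + B ** K) - \<beta> *\<^sub>R P) \<and>
           psd (transpose A ** P ** A - \<phi> *\<^sub>R P) \<and>
           (1 - \<sigma>) * ln \<beta> + \<sigma> * ln \<phi> > 0"
  shows "AE \<omega> in M. filterlim (\<lambda>t. norm (x t \<omega>)) at_top sequentially"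
proof -
  obtain P \<beta> \<phi> where P: "pos_def (P :: real^'n^'n)" and \<beta>: "\<beta> \<in> {0<..<1}" and \<phi>: "\<phi> \<in> {1..}"
    and F: "psd (transpose (A + B ** K) ** P ** (A + B ** K) - \<beta> *\<^sub>R P)"
    and G: "psd (transpose A ** P ** A - \<phi> *\<^sub>R P)"
    and pos: "(1 - \<sigma>) * ln \<beta> + \<sigma> * ln \<phi> > 0"
    using assms(9) by blast
  show ?thesis
    using assms(8) AE_space
  proof eventually_elim
    case (elim \<omega>)
    \<comment> \<open>From here on \<omega> is fixed in the almost sure event, and the input is
      eliminated from the state equation.\<close>
    note step = assms(3)[OF elim(2), unfolded assms(4)[OF elim(2)]]
    show ?case
    proof (rule switched_trajectory_diverges[OF P _ _ F G pos, where l = "\<lambda>t. l t \<omega>"])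
      show "l t \<omega> \<in> {0, 1}" for t
        using measurable_space[OF assms(2) elim(2)] by simp
      \<comment> \<open>A success applies the feedback \<open>K\<close>, giving the closed loop; a
        failure sets the input to zero and leaves \<open>A\<close> alone.\<close>
      show "x (Suc t) \<omega> = (A + B ** K) *v x t \<omega>" if "l t \<omega> = 0" for t
        using step[of t] that
        by (simp add: matrix_vector_mult_add_rdistrib matrix_vector_mul_assoc)
      show "x (Suc t) \<omega> = A *v x t \<omega>" if "l t \<omega> = 1" for t
        using step[of t] that by simp
      show "ereal \<sigma> \<le> liminf (\<lambda>k. ereal (real (\<Sum>t<k. l t \<omega>) / real k))"
        using elim(1) by (simp add: loss_count_def)
    \<comment> \<open>The required ordering of the factors follows from \<beta> < 1 \<le>
      \<phi>.\<close>
    qed (use \<beta> \<phi> assms(5)[OF elim(2)] assms(6) in auto)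
  qed
qed

end
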